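(* For every binary relation $B$ on $R$ the following hold. (1) $op_B$ is idempotent. (2) $op_B$ is associative if and only if both $B$ and its complement are transitive. (3) $op_B$ is left-biased if and only if $B$ is strongly connected. (4) $op_B$ is right-biased if and only if the complement of $B$ is strongly connected. (5) $op_B$ is not commutative (assuming $R$ is non-empty).
   Context: $T$ is a (necessarily strong) monad on the category of sets, and $R$ is a set carrying a $T$-algebra structure $\alpha_T:T(R)\to R$. Put $S_T(X)=(X\to R)\to T(X)$ (the selection monad augmented with the auxiliary monad $T$). For $F\in S_T(X)$ and $\gamma:X\to R$ put $\mathbf R(F|\gamma)=\alpha_T(T(\gamma)(F(\gamma)))\in R$. For a binary relation $B$ on $R$, $op_B$ is the family of binary operations $(op_B)_X:S_T(X)^2\to S_T(X)$ (one for every set $X$) given by: $(op_B)_X(G_0,G_1)(\gamma)=G_0(\gamma)$ if $\mathbf R(G_0|\gamma)\;B\;\mathbf R(G_1|\gamma)$, and $(op_B)_X(G_0,G_1)(\gamma)=G_1(\gamma)$ otherwise. The family $op_B$ is said to satisfy an equation (be idempotent, associative, commutative, left-biased, right-biased) if $(op_B)_X$ does for every set $X$. A binary function $f$ is left-biased if $f(x,f(y,x))=f(x,y)$ for all $x,y$, and right-biased if $f(f(x,y),x)=f(y,x)$ for all $x,y$. A relation $Q$ is strongly connected if for all $x,y$ either $xQy$ or $yQx$.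
   Formalization: Parts (3)–(5) are stated except when R is a singleton and every T(X) has at most one element; in that case every S_T(X) has at most one element, so all equations hold and (3)–(5) fail as written (e.g. T(X)=1, R=1: op_B is commutative). *)

theory Defs
  imports "HOL-Library.FuncSet"
begin

text \<open>
  HOL cannot quantify over endofunctors acting on types, so the category of sets is rendered as
  the category of small sets of a universe: its objects are the small subsets of a type \<open>'u\<close>, its
  morphisms \<open>X \<rightarrow> Y\<close> are the elements of \<open>X \<rightarrow>\<^sub>E Y\<close>. The closure conditions are those of a
  Grothendieck universe, up to bijection, whence the injection \<open>f\<close> in \<open>small_Pow\<close>. An infinite
  small set is allowed but not demanded, so that the hereditarily finite case is included too.
\<close>

locale set_universe =
  fixes small :: "'u set \<Rightarrow> bool"
  assumes small_empty: "small {}"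
    and small_subset: "\<And>X Y. small X \<Longrightarrow> Y \<subseteq> X \<Longrightarrow> small Y"
    and small_image: "\<And>X (f :: 'u \<Rightarrow> 'u). small X \<Longrightarrow> small (f ` X)"
    and small_UN: "\<And>I (F :: 'u \<Rightarrow> 'u set).
      small I \<Longrightarrow> (\<And>i. i \<in> I \<Longrightarrow> small (F i)) \<Longrightarrow> small (\<Union>i\<in>I. F i)"
    and small_Pow: "\<And>X. small X \<Longrightarrow>
      \<exists>f :: 'u set \<Rightarrow> 'u. inj_on f (Pow X) \<and> small (f ` Pow X)"

text \<open>
  The action of the functor on \<open>f : X \<rightarrow> Y\<close> is \<open>Tmap X Y f\<close>; the codomain is an argument because
  an element of \<open>X \<rightarrow>\<^sub>E Y\<close> does not determine it.
\<close>

locale set_monad = set_universe small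
  for small :: "'u set \<Rightarrow> bool" +
  fixes T :: "'u set \<Rightarrow> 'u set"
    and Tmap :: "'u set \<Rightarrow> 'u set \<Rightarrow> ('u \<Rightarrow> 'u) \<Rightarrow> 'u \<Rightarrow> 'u"
    and \<eta> :: "'u set \<Rightarrow> 'u \<Rightarrow> 'u"
    and \<mu> :: "'u set \<Rightarrow> 'u \<Rightarrow> 'u"
  assumes T_small: "\<And>X. small X \<Longrightarrow> small (T X)"
    and Tmap_hom: "\<And>X Y f. small X \<Longrightarrow> small Y \<Longrightarrow> f \<in> X \<rightarrow>\<^sub>E Y \<Longrightarrow> Tmap X Y f \<in> T X \<rightarrow>\<^sub>E T Y"
    and Tmap_id: "\<And>X. small X \<Longrightarrow> Tmap X X (\<lambda>x\<in>X. x) = (\<lambda>t\<in>T X. t)"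
    and Tmap_comp: "\<And>X Y Z f g. small X \<Longrightarrow> small Y \<Longrightarrow> small Z \<Longrightarrow>
      f \<in> X \<rightarrow>\<^sub>E Y \<Longrightarrow> g \<in> Y \<rightarrow>\<^sub>E Z \<Longrightarrow>
      Tmap X Z (compose X g f) = compose (T X) (Tmap Y Z g) (Tmap X Y f)"
    and unit_hom: "\<And>X. small X \<Longrightarrow> \<eta> X \<in> X \<rightarrow>\<^sub>E T X"
    and unit_natural: "\<And>X Y f. small X \<Longrightarrow> small Y \<Longrightarrow> f \<in> X \<rightarrow>\<^sub>E Y \<Longrightarrow>
      compose X (Tmap X Y f) (\<eta> X) = compose X (\<eta> Y) f"
    and mult_hom: "\<And>X. small X \<Longrightarrow> \<mu> X \<in> T (T X) \<rightarrow>\<^sub>E T X"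
    and mult_natural: "\<And>X Y f. small X \<Longrightarrow> small Y \<Longrightarrow> f \<in> X \<rightarrow>\<^sub>E Y \<Longrightarrow>
      compose (T (T X)) (Tmap X Y f) (\<mu> X) =
      compose (T (T X)) (\<mu> Y) (Tmap (T X) (T Y) (Tmap X Y f))"
    and unit_left: "\<And>X. small X \<Longrightarrow> compose (T X) (\<mu> X) (\<eta> (T X)) = (\<lambda>t\<in>T X. t)"
    and unit_right: "\<And>X. small X \<Longrightarrow> compose (T X) (\<mu> X) (Tmap X (T X) (\<eta> X)) = (\<lambda>t\<in>T X. t)"
    and mult_assoc: "\<And>X. small X \<Longrightarrow>
      compose (T (T (T X))) (\<mu> X) (\<mu> (T X)) =
      compose (T (T (T X))) (\<mu> X) (Tmap (T (T X)) (T X) (\<mu> X))"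

locale monad_algebra = set_monad small T Tmap \<eta> \<mu>
  for small :: "'u set \<Rightarrow> bool" and T Tmap \<eta> \<mu> +
  fixes R :: "'u set" and \<alpha> :: "'u \<Rightarrow> 'u"
  assumes R_small: "small R"
    and alg_hom: "\<alpha> \<in> T R \<rightarrow>\<^sub>E R"
    and alg_unit: "compose R \<alpha> (\<eta> R) = (\<lambda>r\<in>R. r)"
    and alg_mult: "compose (T (T R)) \<alpha> (\<mu> R) = compose (T (T R)) \<alpha> (Tmap (T R) R \<alpha>)"

definition selection :: "('u set \<Rightarrow> 'u set) \<Rightarrow> 'u set \<Rightarrow> 'u set \<Rightarrow> (('u \<Rightarrow> 'u) \<Rightarrow> 'u) set" where
  "selection T R X = (X \<rightarrow>\<^sub>E R) \<rightarrow>\<^sub>E T X"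

text \<open>\<open>\<^bold>R(F|\<gamma>)\<close>, for \<open>F \<in> selection T R X\<close> and \<open>\<gamma> \<in> X \<rightarrow>\<^sub>E R\<close>:\<close>

definition reward ::
  "('u set \<Rightarrow> 'u set \<Rightarrow> ('u \<Rightarrow> 'u) \<Rightarrow> 'u \<Rightarrow> 'u) \<Rightarrow> 'u set \<Rightarrow> ('u \<Rightarrow> 'u) \<Rightarrow> 'u set \<Rightarrow>
    (('u \<Rightarrow> 'u) \<Rightarrow> 'u) \<Rightarrow> ('u \<Rightarrow> 'u) \<Rightarrow> 'u" where
  "reward Tmap R \<alpha> X F \<gamma> = \<alpha> (Tmap X R \<gamma> (F \<gamma>))"

definition choice_op ::
  "('u set \<Rightarrow> 'u set \<Rightarrow> ('u \<Rightarrow> 'u) \<Rightarrow> 'u \<Rightarrow> 'u) \<Rightarrow> 'u set \<Rightarrow> ('u \<Rightarrow> 'u) \<Rightarrow> 'u rel \<Rightarrow> 'u set \<Rightarrow>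
    (('u \<Rightarrow> 'u) \<Rightarrow> 'u) \<Rightarrow> (('u \<Rightarrow> 'u) \<Rightarrow> 'u) \<Rightarrow> ('u \<Rightarrow> 'u) \<Rightarrow> 'u" where
  "choice_op Tmap R \<alpha> B X G0 G1 = (\<lambda>\<gamma>\<in>X \<rightarrow>\<^sub>E R.
     if (reward Tmap R \<alpha> X G0 \<gamma>, reward Tmap R \<alpha> X G1 \<gamma>) \<in> B then G0 \<gamma> else G1 \<gamma>)"

definition idempotent_on :: "'a set \<Rightarrow> ('a \<Rightarrow> 'a \<Rightarrow> 'a) \<Rightarrow> bool" where
  "idempotent_on A f \<longleftrightarrow> (\<forall>x\<in>A. f x x = x)"

definition associative_on :: "'a set \<Rightarrow> ('a \<Rightarrow> 'a \<Rightarrow> 'a) \<Rightarrow> bool" where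
  "associative_on A f \<longleftrightarrow> (\<forall>x\<in>A. \<forall>y\<in>A. \<forall>z\<in>A. f (f x y) z = f x (f y z))"

definition commutative_on :: "'a set \<Rightarrow> ('a \<Rightarrow> 'a \<Rightarrow> 'a) \<Rightarrow> bool" where
  "commutative_on A f \<longleftrightarrow> (\<forall>x\<in>A. \<forall>y\<in>A. f x y = f y x)"

definition left_biased_on :: "'a set \<Rightarrow> ('a \<Rightarrow> 'a \<Rightarrow> 'a) \<Rightarrow> bool" where
  "left_biased_on A f \<longleftrightarrow> (\<forall>x\<in>A. \<forall>y\<in>A. f x (f y x) = f x y)"

definition right_biased_on :: "'a set \<Rightarrow> ('a \<Rightarrow> 'a \<Rightarrow> 'a) \<Rightarrow> bool" where
  "right_biased_on A f \<longleftrightarrow> (\<forall>x\<in>A. \<forall>y\<in>A. f (f x y) x = f y x)"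

definition op_satisfies ::
  "('u set \<Rightarrow> bool) \<Rightarrow> ('u set \<Rightarrow> 'u set) \<Rightarrow> ('u set \<Rightarrow> 'u set \<Rightarrow> ('u \<Rightarrow> 'u) \<Rightarrow> 'u \<Rightarrow> 'u) \<Rightarrow>
    'u set \<Rightarrow> ('u \<Rightarrow> 'u) \<Rightarrow> 'u rel \<Rightarrow>
    ((('u \<Rightarrow> 'u) \<Rightarrow> 'u) set \<Rightarrow>
      ((('u \<Rightarrow> 'u) \<Rightarrow> 'u) \<Rightarrow> (('u \<Rightarrow> 'u) \<Rightarrow> 'u) \<Rightarrow> ('u \<Rightarrow> 'u) \<Rightarrow> 'u) \<Rightarrow> bool) \<Rightarrow> bool" where
  "op_satisfies small T Tmap R \<alpha> B law \<longleftrightarrow>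
     (\<forall>X. small X \<longrightarrow> law (selection T R X) (choice_op Tmap R \<alpha> B X))"

text \<open>Unlike \<open>total_on\<close>, strong connectedness includes reflexivity.\<close>

definition strongly_connected_on :: "'a set \<Rightarrow> 'a rel \<Rightarrow> bool" where
  "strongly_connected_on A Q \<longleftrightarrow> (\<forall>x\<in>A. \<forall>y\<in>A. (x, y) \<in> Q \<or> (y, x) \<in> Q)"

text \<open>
  The only case in which the claims about left bias, right bias and commutativity fail: \<open>R\<close> is a
  one-point algebra of an inconsistent monad, that is, every \<open>T X\<close> has at most one element.
  Then every \<open>selection T R X\<close> has at most one element, so that every operation on it satisfies
  all equations. If \<open>R\<close> has two elements, every monad of which it is an algebra is consistent.
\<close>

definition degenerate :: "('u set \<Rightarrow> bool) \<Rightarrow> ('u set \<Rightarrow> 'u set) \<Rightarrow> 'u set \<Rightarrow> bool" where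
  "degenerate small T R \<longleftrightarrow>
     is_singleton R \<and> (\<forall>X. small X \<longrightarrow> (\<forall>s\<in>T X. \<forall>t\<in>T X. s = t))"

end

theory Submission
  imports Defs
begin

text \<open>
  At a fixed \<open>\<gamma>\<close>, the operation only compares the values \<open>\<alpha> (Tmap X R \<gamma> t)\<close> of the two elements
  chosen, so the positive directions are case distinctions on \<open>B\<close>. For the converses one needs
  distinct elements of some \<open>T X\<close> with prescribed values. If \<open>R\<close> has two elements then every unit is
  injective, since maps into \<open>R\<close> separate points and factor through the unit; three distinct points
  in a small set of subsets of \<open>R\<close> then realise any three values. If \<open>R\<close> is a singleton, two distinct
  elements \<open>s\<close>, \<open>t\<close> of \<open>T Z\<close> are themselves the points to use: \<open>\<eta> (T Z)\<close> is a split monomorphism.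
\<close>

section \<open>Evaluating the operation at a single \<open>\<gamma>\<close>\<close>

lemma choice_op_apply:
  assumes "\<gamma> \<in> X \<rightarrow>\<^sub>E R"
  shows "choice_op Tmap R \<alpha> B X F G \<gamma> =
    (if (\<alpha> (Tmap X R \<gamma> (F \<gamma>)), \<alpha> (Tmap X R \<gamma> (G \<gamma>))) \<in> B then F \<gamma> else G \<gamma>)"
  using assms by (simp add: choice_op_def reward_def)

text \<open>Equality of selection functions is equality of total functions, so \<open>ext\<close>
  also asks about arguments outside the hom-set.\<close>

lemma choice_op_outside:
  assumes "\<gamma> \<notin> X \<rightarrow>\<^sub>E R"
  shows "choice_op Tmap R \<alpha> B X F G \<gamma> = undefined"
  using assms by (simp only: choice_op_def restrict_def if_False)

lemma op_satisfiesD: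
  assumes "op_satisfies small T Tmap R \<alpha> B law" "small X"
  shows "law (selection T R X) (choice_op Tmap R \<alpha> B X)"
  using assms by (simp add: op_satisfies_def)

lemma op_idempotent: "op_satisfies small T Tmap R \<alpha> B idempotent_on"
  unfolding op_satisfies_def idempotent_on_def
proof (intro allI impI ballI)
  fix X F assume "F \<in> selection T R X"
  then show "choice_op Tmap R \<alpha> B X F F = F"
    by (simp add: choice_op_def selection_def PiE_restrict)
qed

section \<open>Realising prescribed values by distinct elements of some \<open>T X\<close>\<close>

context monad_algebra
begin

text \<open>Supplies the test arguments: a law is refuted at a single \<open>\<gamma>\<close>, so
  selection functions that ignore \<open>\<gamma>\<close> suffice.\<close>

lemma const_selection: "s \<in> T X \<Longrightarrow> (\<lambda>\<gamma>\<in>X \<rightarrow>\<^sub>E R. s) \<in> selection T R X"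
  by (simp add: selection_def)

lemma algebra_map_in:
  assumes "small X" "\<gamma> \<in> X \<rightarrow>\<^sub>E R" "t \<in> T X"
  shows "\<alpha> (Tmap X R \<gamma> t) \<in> R"
  using PiE_mem[OF alg_hom PiE_mem[OF Tmap_hom[OF assms(1) R_small assms(2)] assms(3)]] .

lemma reward_in:
  assumes "small X" "F \<in> selection T R X" "\<gamma> \<in> X \<rightarrow>\<^sub>E R"
  shows "\<alpha> (Tmap X R \<gamma> (F \<gamma>)) \<in> R"
  using algebra_map_in[OF assms(1,3)] PiE_mem[OF assms(2)[unfolded selection_def] assms(3)] .

text \<open>Naturality moves the unit past \<gamma>, and the unit law of the algebra then cancels
  it: \<open>\<alpha> \<circ> T \<gamma>\<close> extends \<gamma> along the unit.\<close>

lemma algebra_map_unit: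
  assumes "small X" "\<gamma> \<in> X \<rightarrow>\<^sub>E R" "x \<in> X"
  shows "\<alpha> (Tmap X R \<gamma> (\<eta> X x)) = \<gamma> x"
proof -
  have "Tmap X R \<gamma> (\<eta> X x) = \<eta> R (\<gamma> x)"
    using fun_cong[OF unit_natural[OF assms(1) R_small assms(2)], of x] assms(3)
    by (simp add: compose_def)
  moreover have "\<alpha> (\<eta> R (\<gamma> x)) = \<gamma> x"
    using fun_cong[OF alg_unit, of "\<gamma> x"] PiE_mem[OF assms(2,3)] by (simp add: compose_def)
  ultimately show ?thesis by simp
qed

lemma unit_in: "small X \<Longrightarrow> x \<in> X \<Longrightarrow> \<eta> X x \<in> T X"
  using PiE_mem[OF unit_hom] .

lemma unit_inj:
  assumes "p \<in> R" "q \<in> R" "p \<noteq> q" "small X"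
  shows "inj_on (\<eta> X) X"
proof (rule inj_onI, rule ccontr)
  fix x y assume xy: "x \<in> X" "y \<in> X" "\<eta> X x = \<eta> X y" "x \<noteq> y"
  let ?g = "\<lambda>z\<in>X. if z = x then p else q"
  have g: "?g \<in> X \<rightarrow>\<^sub>E R" using assms by auto
  have "?g x = ?g y"
    using algebra_map_unit[OF \<open>small X\<close> g] xy(1-3) by metis
  then show False using xy assms(3) by simp
qed

lemma realise_three:
  assumes "p \<in> R" "q \<in> R" "p \<noteq> q" and abc: "a \<in> R" "b \<in> R" "c \<in> R"
  obtains X \<gamma> s t u where "small X" "\<gamma> \<in> X \<rightarrow>\<^sub>E R" "s \<in> T X" "t \<in> T X" "u \<in> T X"
    "s \<noteq> t" "s \<noteq> u" "t \<noteq> u"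
    "\<alpha> (Tmap X R \<gamma> s) = a" "\<alpha> (Tmap X R \<gamma> t) = b" "\<alpha> (Tmap X R \<gamma> u) = c"
proof -
  obtain f :: "'u set \<Rightarrow> 'u" where f: "inj_on f (Pow R)" "small (f ` Pow R)"
    using small_Pow[OF R_small] by blast
  define X where "X = f ` Pow R"
  \<comment> \<open>\<open>R\<close> itself may have only two points, so the three points are taken
    from a copy of its power set. They are distinct even when \<open>a\<close>, \<open>b\<close>,
    \<open>c\<close> are not.\<close>
  define x y z where "x = f {}" and "y = f {p}" and "z = f {q}"
  have mem: "x \<in> X" "y \<in> X" "z \<in> X"
    using assms unfolding X_def x_def y_def z_def by auto
  have neq: "x \<noteq> y" "x \<noteq> z" "y \<noteq> z"
    using assms(1-3) unfolding x_def y_def z_def by (auto dest!: inj_onD[OF f(1)])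
  have X: "small X" using f(2) by (simp add: X_def)
  define \<gamma> where "\<gamma> = (\<lambda>w\<in>X. if w = x then a else if w = y then b else c)"
  have \<gamma>: "\<gamma> \<in> X \<rightarrow>\<^sub>E R" using abc by (auto simp: \<gamma>_def)
  show thesis
  proof (rule that[OF X \<gamma>, of "\<eta> X x" "\<eta> X y" "\<eta> X z"])
    show "\<alpha> (Tmap X R \<gamma> (\<eta> X x)) = a" "\<alpha> (Tmap X R \<gamma> (\<eta> X y)) = b"
      "\<alpha> (Tmap X R \<gamma> (\<eta> X z)) = c"
      unfolding algebra_map_unit[OF X \<gamma> mem(1)] algebra_map_unit[OF X \<gamma> mem(2)]
        algebra_map_unit[OF X \<gamma> mem(3)]
      using mem neq by (auto simp: \<gamma>_def)
  qed (use unit_in[OF X] mem neq inj_onD[OF unit_inj[OF assms(1-3) X]] in blast)+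
qed

text \<open>The case \<open>a = b\<close> matters: it gives the diagonal part of strong
  connectedness, and non-commutativity.\<close>

lemma realise_two:
  assumes nondeg: "\<not> degenerate small T R" and ab: "a \<in> R" "b \<in> R"
  obtains X \<gamma> s t where "small X" "\<gamma> \<in> X \<rightarrow>\<^sub>E R" "s \<in> T X" "t \<in> T X" "s \<noteq> t"
    "\<alpha> (Tmap X R \<gamma> s) = a" "\<alpha> (Tmap X R \<gamma> t) = b"
proof (cases "is_singleton R")
  case True
  then have "b = a" using ab by (auto simp: is_singleton_def)
  obtain Z s t where Z: "small Z" "s \<in> T Z" "t \<in> T Z" "s \<noteq> t"
    using nondeg True unfolding degenerate_def by blast
  \<comment> \<open>\<open>unit_inj\<close> needs two elements of \<open>R\<close>; here
    \<open>\<mu> Z\<close> serves as a left inverse instead.\<close>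
  have split: "\<mu> Z (\<eta> (T Z) w) = w" if "w \<in> T Z" for w
    using fun_cong[OF unit_left[OF Z(1)], of w] that by (simp add: compose_def)
  have TZ: "small (T Z)" using T_small[OF Z(1)] .
  define \<gamma> where "\<gamma> = (\<lambda>w\<in>T Z. a)"
  have \<gamma>: "\<gamma> \<in> T Z \<rightarrow>\<^sub>E R" using ab by (auto simp: \<gamma>_def)
  show thesis
  proof (rule that[OF TZ \<gamma>, of "\<eta> (T Z) s" "\<eta> (T Z) t"])
    show "\<eta> (T Z) s \<noteq> \<eta> (T Z) t" using split Z by metis
    show "\<alpha> (Tmap (T Z) R \<gamma> (\<eta> (T Z) s)) = a" "\<alpha> (Tmap (T Z) R \<gamma> (\<eta> (T Z) t)) = b"
      using algebra_map_unit[OF TZ \<gamma>] Z \<open>b = a\<close> by (auto simp: \<gamma>_def)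
  qed (use unit_in[OF TZ] Z in blast)+
next
  case False
  then obtain q where "q \<in> R" "a \<noteq> q"
    using ab(1) by (metis is_singletonI' empty_iff)
  \<comment> \<open>The third value is a dummy, and its element is discarded.\<close>
  then show thesis
    using realise_three[OF ab(1) \<open>q \<in> R\<close> \<open>a \<noteq> q\<close> ab ab(1)] that by metis
qed

section \<open>The equational laws\<close>

lemma op_associative_iff:
  assumes "B \<subseteq> R \<times> R"
  shows "op_satisfies small T Tmap R \<alpha> B associative_on \<longleftrightarrow> trans B \<and> trans (R \<times> R - B)"
proof
  assume assoc: "op_satisfies small T Tmap R \<alpha> B associative_on"
  \<comment> \<open>Read with both sides of \<open>same\<close> true, this is transitivity of
    \<open>B\<close>; with both false, transitivity of the complement.\<close>
  have key: "(a, c) \<in> B \<longleftrightarrow> (a, b) \<in> B"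
    if abc: "a \<in> R" "b \<in> R" "c \<in> R" and same: "(a, b) \<in> B \<longleftrightarrow> (b, c) \<in> B" for a b c
  \<comment> \<open>If neighbours coincide, the claim restates \<open>same\<close> or is trivial;
    otherwise \<open>R\<close> has the two elements that \<open>realise_three\<close>
    requires.\<close>
  proof (cases "a = b \<or> b = c")
    case True
    then show ?thesis using same by auto
  next
    case False
    then have "a \<noteq> b" by simp
    obtain X \<gamma> s t u where X: "small X" "\<gamma> \<in> X \<rightarrow>\<^sub>E R" "s \<in> T X" "t \<in> T X" "u \<in> T X"
      "s \<noteq> t" "s \<noteq> u" "t \<noteq> u"
      "\<alpha> (Tmap X R \<gamma> s) = a" "\<alpha> (Tmap X R \<gamma> t) = b" "\<alpha> (Tmap X R \<gamma> u) = c"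
      by (rule realise_three[OF abc(1,2) \<open>a \<noteq> b\<close> abc])
    \<comment> \<open>If both comparisons hold, bracketing to the right gives \<open>s\<close> while
      bracketing to the left compares \<open>s\<close> with \<open>u\<close>. If both fail, the left
      gives \<open>u\<close> and the right compares \<open>s\<close> with \<open>u\<close>. As
      \<open>s \<noteq> u\<close>, the outcome of that comparison is forced.\<close>
    from fun_cong[OF op_satisfiesD[OF assoc X(1), unfolded associative_on_def,
      THEN bspec, OF const_selection[OF X(3)],
      THEN bspec, OF const_selection[OF X(4)],
      THEN bspec, OF const_selection[OF X(5)]], of \<gamma>]
    show ?thesis
      using X(6-) same by (auto simp: choice_op_apply[OF X(2)] X(2) split: if_splits)
  qed
  show "trans B \<and> trans (R \<times> R - B)"
  proof
    show "trans B"
    proof (rule transI)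
      fix a b c assume "(a, b) \<in> B" "(b, c) \<in> B"
      then show "(a, c) \<in> B" using key[of a b c] assms by blast
    qed
    show "trans (R \<times> R - B)"
    proof (rule transI)
      fix a b c assume "(a, b) \<in> R \<times> R - B" "(b, c) \<in> R \<times> R - B"
      then show "(a, c) \<in> R \<times> R - B" using key[of a b c] by blast
    qed
  qed
next
  assume "trans B \<and> trans (R \<times> R - B)"
  then have trB: "trans B" and trC: "trans (R \<times> R - B)" by auto
  \<comment> \<open>The complement is relative to \<open>R \<times> R\<close>, so rewards must be
    known to lie in \<open>R\<close>, which is what \<open>reward_in\<close> provides below.\<close>
  have neg: "(a, c) \<notin> B"
    if "a \<in> R" "b \<in> R" "c \<in> R" "(a, b) \<notin> B" "(b, c) \<notin> B" for a b c
    using transD[OF trC, of a b c] that by blast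
  show "op_satisfies small T Tmap R \<alpha> B associative_on"
    unfolding op_satisfies_def associative_on_def
  proof (intro allI impI ballI ext)
    fix X F G H \<gamma>
    assume X: "small X" and FGH: "F \<in> selection T R X" "G \<in> selection T R X" "H \<in> selection T R X"
    let ?f = "choice_op Tmap R \<alpha> B X"
    show "?f (?f F G) H \<gamma> = ?f F (?f G H) \<gamma>"
    proof (cases "\<gamma> \<in> X \<rightarrow>\<^sub>E R")
      case True
      let ?v = "\<lambda>F. \<alpha> (Tmap X R \<gamma> (F \<gamma>))"
      \<comment> \<open>Transitivity settles the cases in which the comparisons of \<open>F\<close>
        with \<open>G\<close> and of \<open>G\<close> with \<open>H\<close> agree; if they disagree,
        both bracketings coincide anyway.\<close>
      have "(?v F, ?v G) \<in> B \<Longrightarrow> (?v G, ?v H) \<in> B \<Longrightarrow> (?v F, ?v H) \<in> B"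
        using transD[OF trB] .
      moreover have "(?v F, ?v G) \<notin> B \<Longrightarrow> (?v G, ?v H) \<notin> B \<Longrightarrow> (?v F, ?v H) \<notin> B"
        using neg FGH[THEN reward_in[OF X _ True]] .
      ultimately show ?thesis
        by (simp add: choice_op_apply[OF True])
    qed (simp add: choice_op_outside)
  qed
qed

text \<open>The inner choice matters only if it returns \<open>F\<close>, that is, if
  \<open>G\<close> loses to \<open>F\<close> when asked first. The left side is then
  \<open>F\<close>, so \<open>F\<close> asked first must win against \<open>G\<close>.\<close>

lemma op_left_biased_iff:
  assumes "\<not> degenerate small T R"
  shows "op_satisfies small T Tmap R \<alpha> B left_biased_on \<longleftrightarrow> strongly_connected_on R B"
proof
  assume lb: "op_satisfies small T Tmap R \<alpha> B left_biased_on"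
  show "strongly_connected_on R B"
    unfolding strongly_connected_on_def
  proof (intro ballI)
    fix a b assume ab: "a \<in> R" "b \<in> R"
    obtain X \<gamma> s t where X: "small X" "\<gamma> \<in> X \<rightarrow>\<^sub>E R" "s \<in> T X" "t \<in> T X" "s \<noteq> t"
      "\<alpha> (Tmap X R \<gamma> s) = a" "\<alpha> (Tmap X R \<gamma> t) = b"
      by (rule realise_two[OF assms ab])
    from fun_cong[OF op_satisfiesD[OF lb X(1), unfolded left_biased_on_def,
      THEN bspec, OF const_selection[OF X(3)],
      THEN bspec, OF const_selection[OF X(4)]], of \<gamma>]
    show "(a, b) \<in> B \<or> (b, a) \<in> B"
      using X(5-) by (simp add: choice_op_apply[OF X(2)] X(2) split: if_splits)
  qed
next
  assume sc: "strongly_connected_on R B"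
  show "op_satisfies small T Tmap R \<alpha> B left_biased_on"
    unfolding op_satisfies_def left_biased_on_def
  proof (intro allI impI ballI ext)
    fix X F G \<gamma>
    assume X: "small X" and FG: "F \<in> selection T R X" "G \<in> selection T R X"
    let ?f = "choice_op Tmap R \<alpha> B X"
    show "?f F (?f G F) \<gamma> = ?f F G \<gamma>"
    proof (cases "\<gamma> \<in> X \<rightarrow>\<^sub>E R")
      case True
      note R = FG[THEN reward_in[OF X _ True]]
      let ?v = "\<lambda>F. \<alpha> (Tmap X R \<gamma> (F \<gamma>))"
      have "(?v F, ?v G) \<in> B \<or> (?v G, ?v F) \<in> B"
        using sc R unfolding strongly_connected_on_def by blast
      then show ?thesis
        by (auto simp: choice_op_apply[OF True])
    qed (simp add: choice_op_outside)
  qed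
qed

text \<open>Dually, the inner choice matters only if \<open>F\<close> asked first wins. The left
  side is then \<open>F\<close>, so \<open>G\<close> asked first must lose: \<open>B\<close> may not
  hold in both directions.\<close>

lemma op_right_biased_iff:
  assumes "\<not> degenerate small T R"
  shows "op_satisfies small T Tmap R \<alpha> B right_biased_on \<longleftrightarrow>
    strongly_connected_on R (R \<times> R - B)"
proof
  assume rb: "op_satisfies small T Tmap R \<alpha> B right_biased_on"
  show "strongly_connected_on R (R \<times> R - B)"
    unfolding strongly_connected_on_def
  proof (intro ballI)
    fix a b assume ab: "a \<in> R" "b \<in> R"
    obtain X \<gamma> s t where X: "small X" "\<gamma> \<in> X \<rightarrow>\<^sub>E R" "s \<in> T X" "t \<in> T X" "s \<noteq> t"
      "\<alpha> (Tmap X R \<gamma> s) = a" "\<alpha> (Tmap X R \<gamma> t) = b"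
      by (rule realise_two[OF assms ab])
    from fun_cong[OF op_satisfiesD[OF rb X(1), unfolded right_biased_on_def,
      THEN bspec, OF const_selection[OF X(3)],
      THEN bspec, OF const_selection[OF X(4)]], of \<gamma>]
    show "(a, b) \<in> R \<times> R - B \<or> (b, a) \<in> R \<times> R - B"
      using X(5-) ab by (simp add: choice_op_apply[OF X(2)] X(2) split: if_splits)
  qed
next
  assume sc: "strongly_connected_on R (R \<times> R - B)"
  show "op_satisfies small T Tmap R \<alpha> B right_biased_on"
    unfolding op_satisfies_def right_biased_on_def
  proof (intro allI impI ballI ext)
    fix X F G \<gamma>
    assume X: "small X" and FG: "F \<in> selection T R X" "G \<in> selection T R X"
    let ?f = "choice_op Tmap R \<alpha> B X"
    show "?f (?f F G) F \<gamma> = ?f G F \<gamma>"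
    proof (cases "\<gamma> \<in> X \<rightarrow>\<^sub>E R")
      case True
      note R = FG[THEN reward_in[OF X _ True]]
      let ?v = "\<lambda>F. \<alpha> (Tmap X R \<gamma> (F \<gamma>))"
      have "(?v F, ?v G) \<notin> B \<or> (?v G, ?v F) \<notin> B"
        using sc R unfolding strongly_connected_on_def by blast
      then show ?thesis
        by (auto simp: choice_op_apply[OF True])
    qed (simp add: choice_op_outside)
  qed
qed

text \<open>Two distinct elements of equal value \<open>a\<close> suffice: whether or not
  \<open>(a, a) \<in> B\<close>, the choice depends only on position, so swapping the arguments
  changes it.\<close>

lemma op_not_commutative:
  assumes "\<not> degenerate small T R" "R \<noteq> {}"
  shows "\<not> op_satisfies small T Tmap R \<alpha> B commutative_on"
proof
  assume comm: "op_satisfies small T Tmap R \<alpha> B commutative_on"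
  obtain a where a: "a \<in> R" using assms(2) by blast
  obtain X \<gamma> s t where X: "small X" "\<gamma> \<in> X \<rightarrow>\<^sub>E R" "s \<in> T X" "t \<in> T X" "s \<noteq> t"
    "\<alpha> (Tmap X R \<gamma> s) = a" "\<alpha> (Tmap X R \<gamma> t) = a"
    by (rule realise_two[OF assms(1) a a])
  from fun_cong[OF op_satisfiesD[OF comm X(1), unfolded commutative_on_def,
    THEN bspec, OF const_selection[OF X(3)],
    THEN bspec, OF const_selection[OF X(4)]], of \<gamma>]
  show False
    using X(5-) by (simp add: choice_op_apply[OF X(2)] X(2) split: if_splits)
qed

end

theorem theorem2p6:
  fixes small :: "'u set \<Rightarrow> bool"
    and T :: "'u set \<Rightarrow> 'u set"
    and Tmap :: "'u set \<Rightarrow> 'u set \<Rightarrow> ('u \<Rightarrow> 'u) \<Rightarrow> 'u \<Rightarrow> 'u"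
    and \<eta> \<mu> :: "'u set \<Rightarrow> 'u \<Rightarrow> 'u"
    and R :: "'u set"
    and \<alpha> :: "'u \<Rightarrow> 'u"
    and B :: "'u rel"
  assumes "monad_algebra small T Tmap \<eta> \<mu> R \<alpha>"
    and "B \<subseteq> R \<times> R"
  shows "op_satisfies small T Tmap R \<alpha> B idempotent_on \<and>
    (op_satisfies small T Tmap R \<alpha> B associative_on \<longleftrightarrow> trans B \<and> trans (R \<times> R - B)) \<and>
    (\<not> degenerate small T R \<longrightarrow>
      (op_satisfies small T Tmap R \<alpha> B left_biased_on \<longleftrightarrow> strongly_connected_on R B)) \<and>
    (\<not> degenerate small T R \<longrightarrow>
      (op_satisfies small T Tmap R \<alpha> B right_biased_on \<longleftrightarrow> strongly_connected_on R (R \<times> R - B))) \<and>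
    (\<not> degenerate small T R \<longrightarrow> R \<noteq> {} \<longrightarrow>
      \<not> op_satisfies small T Tmap R \<alpha> B commutative_on)"
proof -
  interpret monad_algebra small T Tmap \<eta> \<mu> R \<alpha> by fact
  show ?thesis
    using op_idempotent op_associative_iff[OF assms(2)] op_left_biased_iff op_right_biased_iff
      op_not_commutative
    by blast
qed

end
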